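(* Let $s,v,m$ be positive integers and $\epsilon\in\{1,-1\}$, excluding the case $\epsilon=-1$, $vm^2\le4$. Put $d=svm/2$, $k=s^2v(vm^2+4\epsilon)/4$, $\xi=d+\sqrt{k}$, $\bar\xi=d-\sqrt{k}$, and $f_\xi(x)=svm-\epsilon s^2v/x$. If $|\bar\xi|<1$, then the pattern continued fraction of $\xi$ has nonnegative terms, and every iterate $f_\xi^n(\infty)$, $n\ge1$, is a semiconvergent of the simple continued fraction expansion of $\xi$.
   Context: Let $\delta_\epsilon=0$ if $\epsilon=1$ and $\delta_\epsilon=1$ if $\epsilon=-1$. Let $v_n=v$ for even $n$ and $v_n=1$ for odd $n$; $a_0=0$, $a_1=1$, $a_{n+1}=v_nma_n+\epsilon a_{n-1}$. For $n\ge0$ let $s_n=\gcd(a_n,s)$, let $m_n$ be the unique integer with $0\le m_n<s/s_n$ and $m_n(a_n/s_n)\equiv-a_{n-1}\pmod{s/s_n}$ (so $m_0=0$), and $\hat\xi_n=(s_nv_nm-\epsilon m_n)/(s/s_n)$. Every rational has exactly two finite continued fraction expansions $[c_0,\dots,c_r]$ with $c_0\in\mathbb{Z}$, $c_1,\dots,c_r\ge1$, whose lengths differ by one. Let $E_0$ be the expansion of $\hat\xi_0$ and $E_n$ ($n\ge1$) the expansion of $\hat\xi_n-\delta_\epsilon$, each chosen with an odd number of terms if $\epsilon=1$ and an even number if $\epsilon=-1$. The pattern continued fraction of $\xi$ is the infinite continued fraction whose terms are the concatenation $E_0,E_1,E_2,\dots$. If $\xi=[c_0;c_1,c_2,\dots]$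 is the simple continued fraction expansion, a semiconvergent of $\xi$ is a number $[c_0,\dots,c_{n-1},b]$ with $n\ge0$ and $0\le b\le c_n$ an integer.
   Formalization: The sign in f_ξ is corrected: the formal statement uses f_ξ(x)=svm+εs²v/x, the map that fixes ξ; with the printed minus sign the claim fails, e.g. s=v=ε=1, m=2 gives ξ=1+√2 and second iterate 3/2, which is not a semiconvergent. *)

theory Defs
  imports Complex_Main "HOL-Library.Stream" "HOL-Number_Theory.Cong"
begin

text \<open>
  The projective line \<open>\<real> \<union> {\<infinity>}\<close> is \<^typ>\<open>real option\<close>, with \<^term>\<open>None\<close> for \<open>\<infinity>\<close>;
  \<open>1/0 = \<infinity>\<close>, \<open>1/\<infinity> = 0\<close> and \<open>c + \<infinity> = \<infinity>\<close>.
\<close>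

fun proj_inverse :: "real option \<Rightarrow> real option" where
  "proj_inverse None = Some 0"
| "proj_inverse (Some x) = (if x = 0 then None else Some (1 / x))"

text \<open>
  The empty continued fraction has value \<open>\<infinity>\<close>, so that \<open>[c] = c + 1/\<infinity> = c\<close>.
\<close>

fun cf_value :: "int list \<Rightarrow> real option" where
  "cf_value [] = None"
| "cf_value (c # cs) = map_option (\<lambda>y. real_of_int c + y) (proj_inverse (cf_value cs))"

definition finite_cf_expansion :: "real \<Rightarrow> int list \<Rightarrow> bool" where
  "finite_cf_expansion x cs \<longleftrightarrow>
     cs \<noteq> [] \<and> (\<forall>c \<in> set (tl cs). c \<ge> 1) \<and> cf_value cs = Some x"

text \<open>
  Simple continued fraction expansion of an irrational number, via its complete quotients.
\<close>

primrec complete_quotient :: "real \<Rightarrow> nat \<Rightarrow> real" where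
  "complete_quotient x 0 = x"
| "complete_quotient x (Suc n) = 1 / frac (complete_quotient x n)"

definition scf_term :: "real \<Rightarrow> nat \<Rightarrow> int" where
  "scf_term x n = \<lfloor>complete_quotient x n\<rfloor>"

text \<open>
  A semiconvergent is a number, so the degenerate value \<open>[c\<^sub>0, 0] = \<infinity>\<close> is not one.
\<close>

definition semiconvergent :: "real \<Rightarrow> real \<Rightarrow> bool" where
  "semiconvergent x y \<longleftrightarrow>
     (\<exists>n b. 0 \<le> b \<and> b \<le> scf_term x n \<and>
            cf_value (map (scf_term x) [0..<n] @ [b]) = Some y)"

definition delta :: "int \<Rightarrow> int" where
  "delta \<epsilon> = (if \<epsilon> = 1 then 0 else 1)"

definition v_seq :: "int \<Rightarrow> nat \<Rightarrow> int" where
  "v_seq v n = (if even n then v else 1)"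

fun a_seq :: "int \<Rightarrow> int \<Rightarrow> int \<Rightarrow> nat \<Rightarrow> int" where
  "a_seq v m \<epsilon> 0 = 0"
| "a_seq v m \<epsilon> (Suc 0) = 1"
| "a_seq v m \<epsilon> (Suc (Suc n)) =
     v_seq v (Suc n) * m * a_seq v m \<epsilon> (Suc n) + \<epsilon> * a_seq v m \<epsilon> n"

definition s_seq :: "int \<Rightarrow> int \<Rightarrow> int \<Rightarrow> int \<Rightarrow> nat \<Rightarrow> int" where
  "s_seq s v m \<epsilon> n = gcd (a_seq v m \<epsilon> n) s"

text \<open>
  For \<open>n = 0\<close> the modulus is \<open>1\<close>, so the value of \<open>a\<^sub>-\<^sub>1\<close> (here \<^term>\<open>a_seq v m \<epsilon> (0 - 1)\<close>)
  is immaterial and \<open>m\<^sub>0 = 0\<close>.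
\<close>

definition m_seq :: "int \<Rightarrow> int \<Rightarrow> int \<Rightarrow> int \<Rightarrow> nat \<Rightarrow> int" where
  "m_seq s v m \<epsilon> n =
     (let sn = s_seq s v m \<epsilon> n in
      THE k. 0 \<le> k \<and> k < s div sn \<and>
             [k * (a_seq v m \<epsilon> n div sn) = - a_seq v m \<epsilon> (n - 1)] (mod (s div sn)))"

definition xi_hat :: "int \<Rightarrow> int \<Rightarrow> int \<Rightarrow> int \<Rightarrow> nat \<Rightarrow> real" where
  "xi_hat s v m \<epsilon> n =
     real_of_int (s_seq s v m \<epsilon> n * v_seq v n * m - \<epsilon> * m_seq s v m \<epsilon> n) /
     real_of_int (s div s_seq s v m \<epsilon> n)"

definition pattern_block :: "int \<Rightarrow> int \<Rightarrow> int \<Rightarrow> int \<Rightarrow> nat \<Rightarrow> int list" where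
  "pattern_block s v m \<epsilon> n =
     (THE cs. finite_cf_expansion
                (if n = 0 then xi_hat s v m \<epsilon> 0
                 else xi_hat s v m \<epsilon> n - real_of_int (delta \<epsilon>)) cs \<and>
              (if \<epsilon> = 1 then odd (length cs) else even (length cs)))"

definition pattern_cf :: "int \<Rightarrow> int \<Rightarrow> int \<Rightarrow> int \<Rightarrow> int stream" where
  "pattern_cf s v m \<epsilon> = flat (smap (pattern_block s v m \<epsilon>) nats)"

text \<open>
  The map \<open>x \<mapsto> svm + \<epsilon>s\<^sup>2v/x\<close> on the projective line.  Since \<open>\<xi> + \<xi>' = svm\<close> and
  \<open>\<xi>\<xi>' = d\<^sup>2 - k = -\<epsilon>s\<^sup>2v\<close>, where \<open>\<xi>'\<close> is the conjugate of \<open>\<xi>\<close>, this is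
  \<open>x \<mapsto> (\<xi> + \<xi>') - \<xi>\<xi>'/x\<close>, whose fixed points are \<open>\<xi>\<close> and \<open>\<xi>'\<close>.  With the opposite sign,
  \<open>svm - \<epsilon>s\<^sup>2v/x\<close>, the map does not fix \<open>\<xi>\<close>, and its iterates need not be semiconvergents: for
  \<open>s = v = \<epsilon> = 1\<close>, \<open>m = 2\<close> one has \<open>\<xi> = 1 + \<surd>2\<close>, and the second iterate would be \<open>3/2\<close>.
\<close>

definition f_xi :: "int \<Rightarrow> int \<Rightarrow> int \<Rightarrow> int \<Rightarrow> real option \<Rightarrow> real option" where
  "f_xi s v m \<epsilon> x =
     map_option (\<lambda>y. real_of_int (s * v * m) + real_of_int (\<epsilon> * s\<^sup>2 * v) * y) (proj_inverse x)"

end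

theory Submission
  imports Defs
begin

text \<open>
  The numbers \<open>\<xi>, \<xi>'\<close> are the roots of \<open>X\<^sup>2 - svm X - \<epsilon>s\<^sup>2v\<close>, so \<open>\<bar>\<xi>'\<bar> < 1\<close> makes \<open>\<xi>\<close> irrational
  and, by evaluating at \<open>-\<epsilon>\<close>, says \<open>s \<le> m\<close> if \<open>\<epsilon> = 1\<close> and \<open>s\<^sup>2v + 2 \<le> svm\<close> if \<open>\<epsilon> = -1\<close>.
  Since \<open>0 \<le> m\<^sub>n < s\<close>, every block of the pattern is then the expansion of a positive number, so its
  terms are nonnegative.

  For the iterates, write \<open>f\<^sup>n(\<infinity>) = p/q\<close> with \<open>p = s v\<^sub>n\<^sub>+\<^sub>1 a\<^sub>n\<^sub>+\<^sub>1\<close> and \<open>q = a\<^sub>n\<close>.  The norm form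
  \<open>(p - q\<xi>)(p - q\<xi>')\<close> equals \<open>\<plusminus>s\<^sup>2\<close> or \<open>\<plusminus>s\<^sup>2v\<close>, while \<open>p/q - \<xi>' > s\<^sup>2v\<close>; hence
  \<open>q\<bar>p - q\<xi>\<bar> < 1\<close>.  Such a fraction has a Farey neighbour on the other side of \<open>\<xi>\<close>, and both ends of
  a Farey interval around \<open>\<xi>\<close> are semiconvergents, because the Euclidean algorithm applied to the
  two ends runs in parallel with the continued fraction algorithm for \<open>\<xi>\<close>.
\<close>

section \<open>Semiconvergents and Farey intervals\<close>

lemma complete_quotient_shift:
  "complete_quotient (1 / frac x) n = complete_quotient x (Suc n)"
  by (induction n) auto

lemma scf_term_shift: "scf_term (1 / frac x) n = scf_term x (Suc n)"
  unfolding scf_term_def complete_quotient_shift ..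

lemma semiconvergent_of_int_le:
  assumes "0 \<le> b" "b \<le> \<lfloor>x\<rfloor>"
  shows "semiconvergent x (of_int b)"
  unfolding semiconvergent_def
  by (rule exI[of _ 0], rule exI[of _ b]) (use assms in \<open>auto simp: scf_term_def\<close>)

text \<open>The terms of \<open>x\<close> are \<open>\<lfloor>x\<rfloor>\<close> followed by those
  of \<open>1 / frac x\<close>. This undoes one step of the continued fraction algorithm;
  \<open>y \<noteq> 0\<close> keeps \<open>1 / y\<close> away from infinity.\<close>

lemma semiconvergent_floor_add_inverse:
  assumes "semiconvergent (1 / frac x) y" "y \<noteq> 0"
  shows "semiconvergent x (of_int \<lfloor>x\<rfloor> + 1 / y)"
proof -
  obtain n b where nb: "0 \<le> b" "b \<le> scf_term (1 / frac x) n"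
    "cf_value (map (scf_term (1 / frac x)) [0..<n] @ [b]) = Some y"
    using assms(1) unfolding semiconvergent_def by blast
  have eq: "map (scf_term x) [0..<Suc n] = \<lfloor>x\<rfloor> # map (scf_term (1 / frac x)) [0..<n]"
    unfolding scf_term_shift
    by (simp add: upt_conv_Cons map_Suc_upt[symmetric] scf_term_def comp_def
        del: upt_Suc complete_quotient.simps(2))
  have "cf_value (map (scf_term x) [0..<Suc n] @ [b]) = Some (of_int \<lfloor>x\<rfloor> + 1 / y)"
    unfolding eq using nb(3) assms(2) by simp
  thus ?thesis
    unfolding semiconvergent_def using nb(1,2) scf_term_shift by metis
qed

text \<open>An integer \<open>j\<close> strictly between \<open>p / q\<close> and \<open>x\<close>
  would lie strictly inside the interval with ends \<open>p / q\<close> and \<open>p' / q'\<close>.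
  The determinant then splits into two summands of size at least \<open>q\<close> and
  \<open>q'\<close>, so it is at least 2 in absolute value.\<close>

lemma no_integer_inside_farey_interval:
  fixes p q p' q' j :: int and x :: real
  assumes "q > 0" "q' > 0" "\<bar>p * q' - p' * q\<bar> = 1"
    and "(of_int p - of_int q * x) * (of_int p' - of_int q' * x) < 0"
  shows "of_int j < x \<Longrightarrow> j * q \<le> p" and "x < of_int j \<Longrightarrow> p \<le> j * q"
proof -
  {
    assume "of_int j < x"
    show "j * q \<le> p"
    proof (rule ccontr)
      assume less: "\<not> j * q \<le> p"
      hence "real_of_int p < of_int j * of_int q"
        by (metis not_le of_int_less_iff of_int_mult)
      also have "\<dots> < of_int q * x" using \<open>of_int j < x\<close> assms(1) by simp
      finally have "of_int p' - of_int q' * x > 0"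
        using assms(4) by (simp add: mult_less_0_iff)
      moreover have "of_int j * of_int q' < of_int q' * x"
        using \<open>of_int j < x\<close> assms(2) by simp
      ultimately have "real_of_int (j * q') < of_int p'" by simp
      hence "1 \<le> p' - j * q'" by linarith
      hence "q \<le> (p' - j * q') * q" using assms(1) by simp
      moreover have "q' \<le> (j * q - p) * q'" using less assms(2) by simp
      ultimately have "q + q' \<le> (p' - j * q') * q + (j * q - p) * q'" by (rule add_mono)
      also have "\<dots> = p' * q - p * q'" by (simp add: algebra_simps)
      finally show False using assms(1-3) by linarith
    qed
  next
    assume "x < of_int j"
    show "p \<le> j * q"
    proof (rule ccontr)
      assume less: "\<not> p \<le> j * q"
      have "of_int q * x < of_int j * of_int q" using \<open>x < of_int j\<close> assms(1) by simp
      also have "\<dots> < real_of_int p" using less by (metis not_le of_int_less_iff of_int_mult)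
      finally have "of_int p' - of_int q' * x < 0"
        using assms(4) by (simp add: mult_less_0_iff)
      moreover have "of_int q' * x < of_int j * of_int q'"
        using \<open>x < of_int j\<close> assms(2) by simp
      ultimately have "real_of_int p' < of_int (j * q')" by simp
      hence "1 \<le> j * q' - p'" by linarith
      hence "q \<le> (j * q' - p') * q" using assms(1) by simp
      moreover have "q' \<le> (p - j * q) * q'" using less assms(2) by simp
      ultimately have "q + q' \<le> (j * q' - p') * q + (p - j * q) * q'" by (rule add_mono)
      also have "\<dots> = p * q' - p' * q" by (simp add: algebra_simps)
      finally show False using assms(1-3) by linarith
    qed
  }
qed

text \<open>Both ends lie in \<open>[c, c + 1]\<close> for \<open>c = \<lfloor>x\<rfloor>\<close>,
  so the map sending \<open>y\<close> to \<open>1 / (y - c)\<close> gives a Farey interval around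
  \<open>1 / frac x\<close> with smaller denominators. The other end may be \<open>1 / 0\<close>,
  since the recursion produces it as soon as \<open>p' = c * q'\<close>.\<close>

lemma semiconvergent_farey_end:
  fixes p q p' q' :: int and x :: real
  assumes "x > 0" "x \<notin> \<rat>" "p \<ge> 0" "q > 0" "p' \<ge> 0" "q' \<ge> 0"
    and "\<bar>p * q' - p' * q\<bar> = 1"
    and "(of_int p - of_int q * x) * (of_int p' - of_int q' * x) < 0"
  shows "semiconvergent x (of_int p / of_int q)"
  using assms
proof (induction "nat (q + q')" arbitrary: x p q p' q' rule: less_induct)
  case less
  define c where "c = \<lfloor>x\<rfloor>"
  show ?case
  proof (cases "q' = 0")
    case True
    \<comment> \<open>With \<open>q' = 0\<close> the determinant is \<open>p' * q\<close> up to
      sign, so the end in question is an integer, and the other end being infinite puts it below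
      \<open>x\<close>.\<close>
    hence "q = 1" "p' = 1"
      using less.prems(4,5,7)
      by (auto simp: abs_mult zmult_eq_1_iff)
    hence "of_int p < x" using less.prems(8) True by simp
    hence "p \<le> c" unfolding c_def by linarith
    thus ?thesis
      using semiconvergent_of_int_le[of p x] less.prems(3) \<open>q = 1\<close> by (simp add: c_def)
  next
    case False
    hence q': "q' > 0" using less.prems(6) by simp
    have "frac x \<noteq> 0" using less.prems(2) by (metis Ints_subset_Rats frac_eq_0_iff subsetD)
    hence frac: "frac x > 0" by (simp add: frac_gt_0_iff frac_eq_0_iff)
    have xc: "x = of_int c + frac x" unfolding c_def frac_def by simp
    have cx: "of_int c < x" "x < of_int (c + 1)" using frac xc frac_lt_1[of x] by linarith+
    have det': "\<bar>p' * q - p * q'\<bar> = 1" using less.prems(7) by linarith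
    have opp': "(of_int p' - of_int q' * x) * (of_int p - of_int q * x) < 0"
      using less.prems(8) by (simp add: mult.commute)
    have bounds: "c * q \<le> p" "p \<le> (c + 1) * q" "c * q' \<le> p'" "p' \<le> (c + 1) * q'"
      using no_integer_inside_farey_interval[OF less.prems(4) q' less.prems(7,8)]
        no_integer_inside_farey_interval[OF q' less.prems(4) det' opp'] cx
      by blast+
    show ?thesis
    proof (cases "p = c * q")
      case True
      have "c \<ge> 0" using less.prems(1) by (simp add: c_def)
      thus ?thesis using semiconvergent_of_int_le[of c x] True less.prems(4) by (simp add: c_def)
    next
      case False
      define r where "r = p - c * q"
      define r' where "r' = p' - c * q'"
      have r: "r > 0" "r' \<ge> 0" "r \<le> q" "r' \<le> q'"
        using False bounds by (auto simp: r_def r'_def algebra_simps)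
      have det: "q * r' - q' * r = - (p * q' - p' * q)"
        by (simp add: r_def r'_def algebra_simps)
      \<comment> \<open>Equality would force \<open>r = q\<close> and \<open>r' = q'\<close>, making
        the determinant \<open>q * r' - q' * r\<close> vanish. Hence the induction measure drops
        strictly.\<close>
      have "r + r' \<noteq> q + q'"
      proof
        assume "r + r' = q + q'"
        hence "r = q" "r' = q'" using r by auto
        thus False using det less.prems(7) by simp
      qed
      hence dec: "nat (r + r') < nat (q + q')" using r by linarith
      have irr: "1 / frac x \<notin> \<rat>"
      proof
        assume "1 / frac x \<in> \<rat>"
        hence "1 / (1 / frac x) \<in> \<rat>" by (rule Rats_divide[OF Rats_1])
        hence "frac x \<in> \<rat>" unfolding divide_divide_eq_right by (simp only: mult_1 div_by_1)
        hence "of_int c + frac x \<in> \<rat>" by (intro Rats_add Rats_of_int)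
        thus False using less.prems(2) unfolding xc[symmetric] by contradiction
      qed
      have fr: "frac x = x - of_int c" by (simp add: frac_def c_def)
      \<comment> \<open>Both differences change sign, so the product stays negative and
        \<open>1 / frac x\<close> again separates the two ends.\<close>
      have e': "of_int q * frac x - of_int r = - (of_int p - of_int q * x)"
        "of_int q' * frac x - of_int r' = - (of_int p' - of_int q' * x)"
        by (simp_all add: fr r_def r'_def algebra_simps)
      have e: "of_int q - of_int r * (1 / frac x) = - (of_int p - of_int q * x) / frac x"
        "of_int q' - of_int r' * (1 / frac x) = - (of_int p' - of_int q' * x) / frac x"
        unfolding e'[symmetric] using frac by (simp_all add: diff_divide_distrib)
      have "(of_int q - of_int r * (1 / frac x)) * (of_int q' - of_int r' * (1 / frac x)) < 0"
        unfolding e using less.prems(8) frac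
        by (auto simp: divide_less_0_iff zero_less_mult_iff mult_less_0_iff)
      hence "semiconvergent (1 / frac x) (of_int q / of_int r)"
        using less.hyps[OF dec, of "1 / frac x" q q'] frac irr r less.prems(4,6,7) det by simp
      hence "semiconvergent x (of_int \<lfloor>x\<rfloor> + 1 / (of_int q / of_int r))"
        by (rule semiconvergent_floor_add_inverse) (use r less.prems(4) in auto)
      also have "of_int \<lfloor>x\<rfloor> + 1 / (of_int q / of_int r) = (of_int p / of_int q :: real)"
        using r less.prems(4) by (simp add: r_def c_def field_simps)
      finally show ?thesis .
    qed
  qed
qed

text \<open>Take for \<open>q'\<close> an inverse of \<open>p\<close> modulo \<open>q\<close>, times
  \<open>\<sigma>\<close>. Then \<open>p' \<ge> 0\<close> follows from
  \<open>p * q' \<ge> 1 \<ge> \<sigma>\<close>.\<close>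

lemma farey_neighbour:
  fixes p q \<sigma> :: int
  assumes "coprime p q" "p > 0" "q > 0" "\<bar>\<sigma>\<bar> = 1"
  obtains p' q' where "p' \<ge> 0" "q' > 0" "q' \<le> q" "p * q' - p' * q = \<sigma>"
proof -
  obtain y where y: "[p * y = 1] (mod q)"
    using cong_solve_coprime_int[OF assms(1)] by blast
  \<comment> \<open>The shift by one selects the residue in \<open>{1..q}\<close> instead of
    \<open>{0..<q}\<close>, so that \<open>q' > 0\<close> even for \<open>q = 1\<close>.\<close>
  define q' where "q' = (\<sigma> * y - 1) mod q + 1"
  have q': "q' > 0" "q' \<le> q"
    unfolding q'_def
    using pos_mod_sign[OF assms(3), of "\<sigma> * y - 1"] pos_mod_bound[OF assms(3), of "\<sigma> * y - 1"]
    by linarith+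
  have "[q' = \<sigma> * y - 1 + 1] (mod q)"
    unfolding q'_def by (intro cong_add cong_refl) (simp add: cong_def)
  hence "[p * q' = p * (\<sigma> * y)] (mod q)" by (intro cong_mult cong_refl) simp
  also have "p * (\<sigma> * y) = \<sigma> * (p * y)" by simp
  also have "[\<sigma> * (p * y) = \<sigma> * 1] (mod q)" using y by (intro cong_mult cong_refl)
  finally have "q dvd p * q' - \<sigma>" by (simp add: cong_iff_dvd_diff)
  then obtain p' where p': "p * q' - \<sigma> = q * p'" by (rule dvdE)
  have "1 \<le> p * q'" using assms(2) q'(1) by (simp add: int_one_le_iff_zero_less)
  hence "0 \<le> q * p'" using p' assms(4) by linarith
  hence "p' \<ge> 0" using assms(3) by (simp add: zero_le_mult_iff)
  thus ?thesis using that q' p' by (simp add: algebra_simps)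
qed

text \<open>Cancelling the gcd only strengthens the bound. The Farey neighbour whose determinant has
  the sign of \<open>t\<close> then lies on the other side of \<open>x\<close>, so the fraction is
  an end of a Farey interval around \<open>x\<close>.\<close>

lemma semiconvergent_if_close:
  fixes p q :: int and x :: real
  assumes "x > 0" "x \<notin> \<rat>" "p > 0" "q > 0"
    and close: "\<bar>of_int p - of_int q * x\<bar> * of_int q < 1"
  shows "semiconvergent x (of_int p / of_int q)"
proof -
  define g where "g = gcd p q"
  obtain a b where ab: "p = g * a" "q = g * b" "coprime a b"
    using gcd_coprime_exists[of p q] assms(3) unfolding g_def
    by (metis gcd_eq_0_iff less_irrefl mult.commute)
  have g: "g \<ge> 1" using assms(3) by (simp add: g_def int_one_le_iff_zero_less)
  have pos: "a > 0" "b > 0" using assms(3,4) g ab by (auto simp: zero_less_mult_iff)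
  define t where "t = of_int a - of_int b * x"
  have "\<bar>of_int p - of_int q * x\<bar> = of_int g * \<bar>t\<bar>"
  proof -
    have "of_int p - of_int q * x = of_int g * t" by (simp add: ab t_def algebra_simps)
    thus ?thesis using g by (simp add: abs_mult)
  qed
  hence "(of_int g * of_int g) * (\<bar>t\<bar> * of_int b) < 1" using close ab(2) by (simp add: mult_ac)
  moreover have "1 \<le> (of_int g * of_int g :: real)"
    using g mult_mono[of 1 "of_int g :: real" 1 "of_int g"] by simp
  hence "1 * (\<bar>t\<bar> * of_int b) \<le> (of_int g * of_int g) * (\<bar>t\<bar> * of_int b)"
    by (rule mult_right_mono) (use pos in auto)
  ultimately have small: "\<bar>t\<bar> * of_int b < 1" by simp
  have "t \<noteq> 0"
  proof
    assume "t = 0"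
    hence "x = of_int a / of_int b" using pos by (simp add: t_def field_simps)
    thus False using assms(2) by auto
  qed
  define \<sigma> :: int where "\<sigma> = (if t > 0 then 1 else -1)"
  have "\<bar>\<sigma>\<bar> = 1" by (simp add: \<sigma>_def)
  obtain a' b' where a'b': "a' \<ge> 0" "b' > 0" "b' \<le> b" "a * b' - a' * b = \<sigma>"
    using farey_neighbour[OF ab(3) pos, of \<sigma>] \<open>\<bar>\<sigma>\<bar> = 1\<close> by blast
  \<comment> \<open>As \<open>b' \<le> b\<close>, the term \<open>b' * t\<close> is less than 1 in
    absolute value, so \<open>- \<sigma>\<close> decides the sign, which is opposite to that of
    \<open>t\<close>.\<close>
  have "of_int b * (of_int a' - of_int b' * x) = of_int b' * t - of_int \<sigma>"
    unfolding a'b'(4)[symmetric] t_def by (simp add: algebra_simps)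
  moreover have "\<bar>of_int b' * t\<bar> < 1"
  proof -
    have "\<bar>of_int b' * t\<bar> = \<bar>t\<bar> * of_int b'" using a'b'(2) by (simp add: abs_mult)
    also have "\<dots> \<le> \<bar>t\<bar> * of_int b" using a'b'(3) by (intro mult_left_mono) auto
    finally show ?thesis using small by simp
  qed
  ultimately have "t * (of_int b * (of_int a' - of_int b' * x)) < 0"
    using \<open>t \<noteq> 0\<close> by (auto simp: \<sigma>_def mult_less_0_iff)
  hence "t * (of_int a' - of_int b' * x) < 0"
    using pos by (simp add: mult_less_0_iff zero_less_mult_iff)
  hence "semiconvergent x (of_int a / of_int b)"
    using semiconvergent_farey_end[of x a b a' b'] assms(1,2) pos a'b'
    by (auto simp: t_def \<sigma>_def split: if_splits)
  thus ?thesis using g by (simp add: ab)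
qed

section \<open>Finite expansions of prescribed parity\<close>

lemma cf_value_ge_1:
  assumes "cs \<noteq> []" "\<forall>c \<in> set cs. c \<ge> 1"
  obtains y where "cf_value cs = Some y" "y \<ge> 1" "y = 1 \<longleftrightarrow> cs = [1]"
  using assms
proof (induction cs arbitrary: thesis)
  case Nil
  thus ?case by simp
next
  case (Cons c cs)
  show ?case
  proof (cases "cs = []")
    case True
    thus ?thesis using Cons.prems by auto
  next
    case False
    obtain y where y: "cf_value cs = Some y" "y \<ge> 1"
      using Cons.IH[OF _ False] Cons.prems(3) by auto
    have "real_of_int c \<ge> 1" using Cons.prems(3) by simp
    moreover have "1 / y > 0" using y by simp
    ultimately have "of_int c + 1 / y > 1" by linarith
    thus ?thesis using Cons.prems(1)[of "of_int c + 1 / y"] y False by auto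
  qed
qed

text \<open>The tail has value \<open>y \<ge> 1\<close>, so \<open>1 / y\<close> lies in the
  half-open interval \<open>(0, 1]\<close>. This is why the first term is
  \<open>\<lceil>x\<rceil> - 1\<close> and not the floor; the two differ exactly at
  integers.\<close>

lemma finite_cf_expansion_ConsE:
  assumes "finite_cf_expansion x (c # cs)" "cs \<noteq> []"
  obtains y where "finite_cf_expansion y cs" "\<forall>d \<in> set cs. d \<ge> 1" "y \<ge> 1" "y = 1 \<longleftrightarrow> cs = [1]"
    "x = of_int c + 1 / y" "c = \<lceil>x\<rceil> - 1"
proof -
  have ge1: "\<forall>d \<in> set cs. d \<ge> 1" using assms(1) by (simp add: finite_cf_expansion_def)
  obtain y where y: "cf_value cs = Some y" "y \<ge> 1" "y = 1 \<longleftrightarrow> cs = [1]"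
    using cf_value_ge_1[OF assms(2) ge1] by blast
  have x: "x = of_int c + 1 / y"
    using assms(1) y(1,2) by (auto simp: finite_cf_expansion_def)
  have "0 < 1 / y" "1 / y \<le> 1" using y(2) by auto
  hence "\<lceil>x\<rceil> = c + 1" unfolding x by (intro ceiling_unique) auto
  hence "c = \<lceil>x\<rceil> - 1" by linarith
  moreover have "finite_cf_expansion y cs"
    using ge1 y(1) assms(2) by (auto simp: finite_cf_expansion_def dest: list.set_sel(2))
  ultimately show ?thesis by (intro that[OF _ ge1 y(2,3) x])
qed

text \<open>If both lists have at least two terms, the first term is forced and the tails have equal
  value. The only ambiguity is \<open>[a]\<close> against \<open>[a - 1, 1]\<close>, which parity
  excludes.\<close>

lemma finite_cf_expansion_unique:
  assumes "finite_cf_expansion x cs" "finite_cf_expansion x ds"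
    and "even (length cs) \<longleftrightarrow> even (length ds)"
  shows "cs = ds"
  using assms
proof (induction cs arbitrary: x ds)
  case Nil
  thus ?case by (simp add: finite_cf_expansion_def)
next
  case (Cons c cs)
  obtain d ds' where ds: "ds = d # ds'"
    using Cons.prems(2) by (cases ds) (auto simp: finite_cf_expansion_def)
  have singleton: False
    if 1: "finite_cf_expansion x [a]" and 2: "finite_cf_expansion x (b # bs)" "bs \<noteq> []"
      and par: "even (length bs)" for a b bs
  proof -
    obtain y where y: "finite_cf_expansion y bs" "\<forall>d \<in> set bs. d \<ge> 1" "y \<ge> 1"
      "y = 1 \<longleftrightarrow> bs = [1]" "x = of_int b + 1 / y" "b = \<lceil>x\<rceil> - 1"
      by (rule finite_cf_expansion_ConsE[OF 2])
    have "x = of_int a" using 1 by (simp add: finite_cf_expansion_def)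
    hence "b = a - 1" using y(6) by (simp only: ceiling_of_int)
    hence "1 / y = 1" using y(5) \<open>x = of_int a\<close> by simp
    hence "bs = [1]" using y(3,4) by simp
    thus False using par by simp
  qed
  show ?case
  proof (cases "cs = [] \<or> ds' = []")
    case True
    have par: "even (length cs) \<longleftrightarrow> even (length ds')" using Cons.prems(3) ds by simp
    have "ds' = []" if "cs = []"
    proof (rule ccontr)
      assume "ds' \<noteq> []"
      thus False using singleton[of c d ds'] Cons.prems(1,2) ds par that by simp
    qed
    moreover have "cs = []" if "ds' = []"
    proof (rule ccontr)
      assume "cs \<noteq> []"
      thus False using singleton[of d c cs] Cons.prems(1,2) ds par that by simp
    qed
    ultimately show ?thesis
      using True Cons.prems(1,2) ds by (auto simp: finite_cf_expansion_def)
  next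
    case False
    have "cs \<noteq> []" "ds' \<noteq> []" using False by auto
    obtain y where y: "finite_cf_expansion y cs" "\<forall>d \<in> set cs. d \<ge> 1" "y \<ge> 1"
      "y = 1 \<longleftrightarrow> cs = [1]" "x = of_int c + 1 / y" "c = \<lceil>x\<rceil> - 1"
      by (rule finite_cf_expansion_ConsE[OF Cons.prems(1) \<open>cs \<noteq> []\<close>])
    obtain z where z: "finite_cf_expansion z ds'" "\<forall>d \<in> set ds'. d \<ge> 1" "z \<ge> 1"
      "z = 1 \<longleftrightarrow> ds' = [1]" "x = of_int d + 1 / z" "d = \<lceil>x\<rceil> - 1"
      by (rule finite_cf_expansion_ConsE[OF Cons.prems(2)[unfolded ds] \<open>ds' \<noteq> []\<close>])
    have "c = d" using y(6) z(6) by (simp only:)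
    moreover have "1 / y = 1 / z" using y(5) z(5) \<open>c = d\<close> by linarith
    hence "y = z" using y(3) z(3) by (simp add: field_simps)
    ultimately show ?thesis
      using Cons.IH[OF y(1), of ds'] z(1) Cons.prems(3) ds by simp
  qed
qed

lemma finite_cf_expansion_nonneg:
  assumes "finite_cf_expansion x cs" "x > 0" "c \<in> set cs"
  shows "c \<ge> 0"
proof -
  obtain b bs where cs: "cs = b # bs" using assms(3) by (cases cs) auto
  have "b \<ge> 0"
  proof (cases "bs = []")
    case True
    thus ?thesis using assms(1,2) cs by (auto simp: finite_cf_expansion_def)
  next
    case False
    have "b = \<lceil>x\<rceil> - 1" using finite_cf_expansion_ConsE[of x b bs] assms(1) cs False by metis
    thus ?thesis using assms(2) by (simp add: less_ceiling_iff)
  qed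
  moreover have "\<forall>c \<in> set bs. c \<ge> 1" using assms(1) cs by (simp add: finite_cf_expansion_def)
  ultimately show ?thesis using assms(3) cs by auto
qed

text \<open>Euclidean algorithm on \<open>p\<close> and \<open>q\<close>. The required parity flips
  at each division and is met at the end, where an integer \<open>c\<close> is written as
  \<open>[c]\<close> or \<open>[c - 1, 1]\<close>.\<close>

lemma finite_cf_expansion_exists:
  fixes p q :: int
  assumes "q > 0"
  shows "\<exists>cs. finite_cf_expansion (of_int p / of_int q) cs \<and> (even (length cs) \<longleftrightarrow> par)"
  using assms
proof (induction "nat q" arbitrary: p q par rule: less_induct)
  case less
  define c where "c = p div q"
  define r where "r = p mod q"
  have p: "p = c * q + r" by (simp add: c_def r_def)
  have r: "0 \<le> r" "r < q" using less.prems by (auto simp: r_def)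
  show ?case
  proof (cases "r = 0")
    case True
    hence x: "of_int p / of_int q = (of_int c :: real)" using p less.prems by simp
    show ?thesis
    proof (cases par)
      case True
      have "finite_cf_expansion (of_int c) [c - 1, 1]" by (simp add: finite_cf_expansion_def)
      thus ?thesis unfolding x using True by (intro exI[of _ "[c - 1, 1]"]) simp
    next
      case False
      have "finite_cf_expansion (of_int c) [c]" by (simp add: finite_cf_expansion_def)
      thus ?thesis unfolding x using False by (intro exI[of _ "[c]"]) simp
    qed
  next
    case False
    hence r0: "r > 0" using r by simp
    obtain cs where cs: "finite_cf_expansion (of_int q / of_int r) cs"
      "even (length cs) \<longleftrightarrow> \<not> par"
      using less.hyps[of r q "\<not> par"] r r0 by auto
    have gt1: "of_int q / of_int r > (1 :: real)" using r r0 by simp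
    obtain b bs where bs: "cs = b # bs"
      using cs(1) by (cases cs) (auto simp: finite_cf_expansion_def)
    \<comment> \<open>The head of \<open>cs\<close> becomes an inner term after prepending
      \<open>c\<close>, so it has to be positive; this comes from \<open>q / r > 1\<close>.\<close>
    have "b \<ge> 1"
    proof (cases "bs = []")
      case True
      hence "of_int q / of_int r = (of_int b :: real)"
        using cs(1) bs by (simp add: finite_cf_expansion_def)
      thus ?thesis using gt1 by simp
    next
      case False
      have "b = \<lceil>of_int q / of_int r :: real\<rceil> - 1"
        using finite_cf_expansion_ConsE[of _ b bs] cs(1) bs False by metis
      moreover have "1 < \<lceil>of_int q / of_int r :: real\<rceil>" using gt1 by (simp add: less_ceiling_iff)
      ultimately show ?thesis by linarith
    qed
    have "finite_cf_expansion (of_int p / of_int q) (c # cs)"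
    proof -
      have "real_of_int p = of_int c * of_int q + of_int r" unfolding p by simp
      hence "of_int p / of_int q = of_int c + 1 / (of_int q / of_int r :: real)"
        using less.prems r0 by (simp add: field_simps)
      moreover have "cf_value cs = Some (of_int q / of_int r)" "\<forall>d \<in> set cs. d \<ge> 1"
        using cs(1) bs \<open>b \<ge> 1\<close> by (auto simp: finite_cf_expansion_def)
      ultimately show ?thesis using r0 less.prems by (simp add: finite_cf_expansion_def)
    qed
    thus ?thesis using cs(2) by (intro exI[of _ "c # cs"]) simp
  qed
qed

section \<open>The pattern continued fraction\<close>

text \<open>The definite description has a unique witness because \<open>a\<close> and
  \<open>t\<close>, the quotients by the gcd, are coprime; its defining property contains the
  bounds.\<close>

lemma m_seq_bounds:
  assumes "s > 0"
  shows "0 \<le> m_seq s v m \<epsilon> n" "m_seq s v m \<epsilon> n < s div s_seq s v m \<epsilon> n"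
proof -
  define g where "g = s_seq s v m \<epsilon> n"
  define a where "a = a_seq v m \<epsilon> n div g"
  define t where "t = s div g"
  let ?P = "\<lambda>k. 0 \<le> k \<and> k < t \<and> [k * a = - a_seq v m \<epsilon> (n - 1)] (mod t)"
  have "g > 0" using assms by (simp add: g_def s_seq_def)
  have "coprime a t"
    unfolding a_def t_def g_def s_seq_def using assms by (intro div_gcd_coprime) auto
  have "g dvd s" by (simp add: g_def s_seq_def)
  hence t: "t > 0" using assms \<open>g > 0\<close> by (simp add: t_def pos_imp_zdiv_pos_iff zdvd_imp_le)
  have "\<exists>!k. ?P k"
  proof (rule ex_ex1I)
    obtain y where "[a * y = 1] (mod t)" using cong_solve_coprime_int[OF \<open>coprime a t\<close>] by blast
    hence "[- a_seq v m \<epsilon> (n - 1) * (a * y) = - a_seq v m \<epsilon> (n - 1) * 1] (mod t)"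
      by (intro cong_mult cong_refl)
    moreover have "[(- a_seq v m \<epsilon> (n - 1) * y) mod t * a = (- a_seq v m \<epsilon> (n - 1) * y) * a] (mod t)"
      by (intro cong_mult cong_refl) (simp add: cong_def)
    ultimately have "?P ((- a_seq v m \<epsilon> (n - 1) * y) mod t)"
      using t by (auto simp: mult_ac intro: cong_trans)
    thus "\<exists>k. ?P k" by blast
  next
    fix k l assume "?P k" "?P l"
    hence "[k * a = l * a] (mod t)" by (meson cong_sym cong_trans)
    hence "[k = l] (mod t)" using \<open>coprime a t\<close> by (simp add: cong_mult_rcancel)
    thus "k = l" using \<open>?P k\<close> \<open>?P l\<close> cong_less_imp_eq_int[of k t l] by blast
  qed
  from theI'[OF this] show "0 \<le> m_seq s v m \<epsilon> n" "m_seq s v m \<epsilon> n < s div s_seq s v m \<epsilon> n"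
    unfolding m_seq_def Let_def g_def[symmetric] t_def a_def by auto
qed

text \<open>The numerator is at least \<open>m - \<epsilon> * k - delta \<epsilon> * t\<close>,
  where \<open>0 \<le> k < t \<le> s\<close>. For \<open>\<epsilon> = 1\<close> this is
  \<open>m - k\<close>, for \<open>\<epsilon> = -1\<close> it is \<open>m + k - t\<close>, and both
  are positive.\<close>

lemma xi_hat_minus_delta_pos:
  assumes "s > 0" "v > 0" "m > 0" "\<epsilon> \<in> {1, -1}" "s \<le> m" "\<epsilon> = -1 \<Longrightarrow> s < m"
  shows "xi_hat s v m \<epsilon> n - of_int (delta \<epsilon>) > 0"
proof -
  define g where "g = s_seq s v m \<epsilon> n"
  define t where "t = s div g"
  define k where "k = m_seq s v m \<epsilon> n"
  have k: "0 \<le> k" "k < t" using m_seq_bounds[OF assms(1)] by (auto simp: k_def t_def g_def)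
  have "g > 0" using assms(1) by (simp add: g_def s_seq_def)
  have "t \<le> s"
  proof -
    have "g * t = s" by (simp add: t_def g_def s_seq_def)
    moreover have "1 * t \<le> g * t" using k \<open>g > 0\<close> by (intro mult_right_mono) auto
    ultimately show ?thesis by simp
  qed
  have "v_seq v n \<ge> 1" using assms(2) by (simp add: v_seq_def)
  hence "1 * 1 \<le> g * v_seq v n" using \<open>g > 0\<close> by (intro mult_mono) auto
  hence le: "1 * m \<le> g * v_seq v n * m" using assms(3) by (intro mult_right_mono) auto
  have num: "g * v_seq v n * m - \<epsilon> * k - delta \<epsilon> * t > 0"
  proof (cases "\<epsilon> = 1")
    case True
    hence "delta \<epsilon> = 0" by (simp add: delta_def)
    show ?thesis
      unfolding \<open>delta \<epsilon> = 0\<close> unfolding True using le assms(5) k \<open>t \<le> s\<close> by linarith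
  next
    case False
    hence "\<epsilon> = -1" "delta \<epsilon> = 1" using assms(4) by (auto simp: delta_def)
    show ?thesis unfolding \<open>delta \<epsilon> = 1\<close>
      unfolding \<open>\<epsilon> = -1\<close> using le assms(6)[OF \<open>\<epsilon> = -1\<close>] k \<open>t \<le> s\<close> by linarith
  qed
  have "t > 0" using k by simp
  have eq: "xi_hat s v m \<epsilon> n - of_int (delta \<epsilon>) =
      of_int (g * v_seq v n * m - \<epsilon> * k - delta \<epsilon> * t) / of_int t"
    using \<open>t > 0\<close> by (simp add: xi_hat_def k_def[symmetric] g_def[symmetric] t_def[symmetric] field_simps)
  show ?thesis unfolding eq
    by (rule divide_pos_pos) (use num \<open>t > 0\<close> in \<open>simp_all only: of_int_0_less_iff\<close>)
qed

lemma pattern_block_nonneg: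
  assumes "s > 0" "v > 0" "m > 0" "\<epsilon> \<in> {1, -1}" "s \<le> m" "\<epsilon> = -1 \<Longrightarrow> s < m"
  shows "pattern_block s v m \<epsilon> n \<noteq> []" "\<forall>c \<in> set (pattern_block s v m \<epsilon> n). c \<ge> 0"
proof -
  define x where "x = (if n = 0 then xi_hat s v m \<epsilon> 0 else xi_hat s v m \<epsilon> n - of_int (delta \<epsilon>))"
  let ?P = "\<lambda>cs. finite_cf_expansion x cs \<and>
    (if \<epsilon> = 1 then odd (length cs) else even (length cs))"
  have "delta \<epsilon> \<ge> 0" by (simp add: delta_def)
  \<comment> \<open>The block of index 0 does not subtract \<open>delta \<epsilon>\<close>, which
    only makes \<open>x\<close> larger.\<close>
  hence "x > 0"
    using xi_hat_minus_delta_pos[OF assms, of n] by (cases "n = 0") (auto simp: x_def)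
  define t where "t = s div s_seq s v m \<epsilon> n"
  have t: "t > 0" using m_seq_bounds[OF assms(1), of v m \<epsilon> n] by (simp add: t_def)
  obtain u :: int where u: "x = of_int u / of_int t"
  proof (cases "n = 0")
    case True
    thus ?thesis
      using that[of "s_seq s v m \<epsilon> n * v_seq v n * m - \<epsilon> * m_seq s v m \<epsilon> n"]
      by (simp add: x_def xi_hat_def t_def)
  next
    case False
    thus ?thesis
      using that[of "s_seq s v m \<epsilon> n * v_seq v n * m - \<epsilon> * m_seq s v m \<epsilon> n - delta \<epsilon> * t"] t
      by (simp add: x_def xi_hat_def t_def[symmetric] diff_divide_distrib)
  qed
  have "\<exists>!cs. ?P cs"
  proof (rule ex_ex1I)
    show "\<exists>cs. ?P cs" using finite_cf_expansion_exists[OF t, of u "\<epsilon> \<noteq> 1"] u by auto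
    show "cs = ds" if "?P cs" "?P ds" for cs ds
      using finite_cf_expansion_unique[of x cs ds] that by (auto split: if_splits)
  qed
  from theI'[OF this] have exp: "finite_cf_expansion x (pattern_block s v m \<epsilon> n)"
    unfolding pattern_block_def x_def by blast
  show "pattern_block s v m \<epsilon> n \<noteq> []" using exp by (simp add: finite_cf_expansion_def)
  show "\<forall>c \<in> set (pattern_block s v m \<epsilon> n). c \<ge> 0"
    using finite_cf_expansion_nonneg[OF exp \<open>x > 0\<close>] by blast
qed

lemma pattern_cf_nonneg:
  assumes "s > 0" "v > 0" "m > 0" "\<epsilon> \<in> {1, -1}" "s \<le> m" "\<epsilon> = -1 \<Longrightarrow> s < m"
  shows "\<forall>c \<in> sset (pattern_cf s v m \<epsilon>). c \<ge> 0"
proof -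
  have "sset (pattern_cf s v m \<epsilon>) = (\<Union>n. set (pattern_block s v m \<epsilon> n))"
    unfolding pattern_cf_def
    \<comment> \<open>Flattening a stream of lists reaches every list only if none of them is
      empty.\<close>
    by (subst sset_flat) (auto simp: stream.set_map pattern_block_nonneg(1)[OF assms])
  thus ?thesis using pattern_block_nonneg(2)[OF assms] by auto
qed

section \<open>The iterates\<close>

text \<open>The rational root theorem for a monic quadratic; applied to \<open>\<xi>\<close>, it
  would turn rationality into integrality of the conjugate.\<close>

lemma int_if_rational_root:
  fixes b c :: int and x :: real
  assumes "x \<in> \<rat>" "x\<^sup>2 - of_int b * x - of_int c = 0"
  shows "x \<in> \<int>"
proof -
  obtain p q :: int where pq: "q > 0" "coprime p q" "x = of_int p / of_int q"
    using assms(1) by (metis Rats_cases')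
  have "(of_int p :: real)\<^sup>2 = of_int q * (of_int b * of_int p + of_int c * of_int q)"
    using assms(2) pq(1) by (simp add: pq(3) field_simps power2_eq_square)
  hence "p\<^sup>2 = q * (b * p + c * q)"
    by (metis (no_types) of_int_add of_int_eq_iff of_int_mult of_int_power)
  hence "q dvd p\<^sup>2" by simp
  moreover have "coprime (p\<^sup>2) q" using pq(2) by simp
  ultimately have "q dvd 1" using coprime_common_divisor[of "p\<^sup>2" q q] by simp
  hence "q = 1" using pq(1) by simp
  thus ?thesis using pq(3) by simp
qed

text \<open>
  The integers \<open>a, a'\<close> are \<open>a\<^sub>n, a\<^sub>n\<^sub>+\<^sub>1\<close>; the two alternatives are \<open>n\<close> odd and \<open>n\<close> even.
\<close>

lemma f_xi_iterate:
  fixes s v m \<epsilon> :: int and \<xi> \<xi>' :: real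
  assumes "s > 0" "v > 0" "m > 0" "\<epsilon> \<in> {1, -1}"
    and sum: "\<xi> + \<xi>' = of_int (s * v * m)" and prod: "\<xi> * \<xi>' = - of_int (\<epsilon> * s\<^sup>2 * v)"
    and "\<xi> > 0"
  shows "\<exists>x. (f_xi s v m \<epsilon> ^^ Suc n) None = Some x \<and>
    (\<epsilon> = 1 \<longrightarrow> x \<ge> of_int (s * v * m)) \<and> (\<epsilon> = -1 \<longrightarrow> x > \<xi>) \<and>
    (\<exists>a a'. a > 0 \<and> a' > 0 \<and>
      (x = of_int (s * v * a') / of_int a \<and> \<bar>v * a'\<^sup>2 - v * m * a' * a - \<epsilon> * a\<^sup>2\<bar> = 1 \<or>
       x = of_int (s * a') / of_int a \<and> \<bar>a'\<^sup>2 - v * m * a' * a - \<epsilon> * v * a\<^sup>2\<bar> = 1))"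
proof (induction n)
  case 0
  have "\<xi> < of_int (s * v * m)" if "\<epsilon> = -1"
  proof -
    have "\<xi> * \<xi>' > 0" using prod that assms(1,2) by simp
    hence "\<xi>' > 0" using assms(7) by (simp add: zero_less_mult_iff)
    thus ?thesis using sum by simp
  qed
  \<comment> \<open>The first iterate is \<open>s * v * m\<close>, given by \<open>a = 1\<close> and
    \<open>a' = m\<close> in the first alternative, where the form takes the value
    \<open>- \<epsilon>\<close>.\<close>
  thus ?case using assms(3,4)
    by (intro exI[of _ "of_int (s * v * m)"] conjI exI[of _ 1] exI[of _ m])
      (auto simp: f_xi_def power2_eq_square)
next
  case (Suc n)
  then obtain x a a' where x: "(f_xi s v m \<epsilon> ^^ Suc n) None = Some x"
    and lower: "\<epsilon> = 1 \<Longrightarrow> x \<ge> of_int (s * v * m)" "\<epsilon> = -1 \<Longrightarrow> x > \<xi>"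
    and a: "a > 0" "a' > 0"
    and cases: "x = of_int (s * v * a') / of_int a \<and> \<bar>v * a'\<^sup>2 - v * m * a' * a - \<epsilon> * a\<^sup>2\<bar> = 1 \<or>
       x = of_int (s * a') / of_int a \<and> \<bar>a'\<^sup>2 - v * m * a' * a - \<epsilon> * v * a\<^sup>2\<bar> = 1"
    by blast
  have svm: "s * v * m > 0" using assms by simp
  have "x > 0" using cases a assms(1,2) by auto
  define y where "y = of_int (s * v * m) + of_int (\<epsilon> * s\<^sup>2 * v) * (1 / x)"
  have fy: "(f_xi s v m \<epsilon> ^^ Suc (Suc n)) None = Some y"
    unfolding funpow.simps(2)[of "Suc n"] comp_apply x
    using \<open>x > 0\<close> by (simp add: f_xi_def y_def)
  have y1: "y \<ge> of_int (s * v * m)" if "\<epsilon> = 1"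
    using that \<open>x > 0\<close> assms(2) by (simp add: y_def)
  \<comment> \<open>The map sends \<open>x\<close> to
    \<open>\<xi> + \<xi>' - \<xi> * \<xi>' / x\<close>. For \<open>\<epsilon> = -1\<close> both
    roots are positive, so \<open>x > \<xi>\<close> gives a value above \<open>\<xi>\<close>
    again.\<close>
  have y2: "y > \<xi>" if "\<epsilon> = -1"
  proof -
    have "\<xi> * \<xi>' > 0" using prod that assms(1,2) by simp
    hence "\<xi>' > 0" using assms(7) by (simp add: zero_less_mult_iff)
    have "y = \<xi> + \<xi>' - (\<xi> * \<xi>') / x"
      using sum prod that by (simp add: y_def)
    moreover have "(\<xi> * \<xi>') / x < \<xi>'"
      using lower(2)[OF that] \<open>x > 0\<close> \<open>\<xi>' > 0\<close> by (simp add: field_simps)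
    ultimately show ?thesis by simp
  qed
  have "y > 0"
  proof (cases "\<epsilon> = 1")
    case True
    have "(0::real) < of_int (s * v * m)" using svm by (simp only: of_int_0_less_iff)
    thus ?thesis using y1[OF True] by linarith
  next
    case False
    hence "\<epsilon> = -1" using assms(4) by simp
    thus ?thesis using y2 assms(7) by simp
  qed
  from cases have "\<exists>b b'. b > 0 \<and> b' > 0 \<and>
      (y = of_int (s * v * b') / of_int b \<and> \<bar>v * b'\<^sup>2 - v * m * b' * b - \<epsilon> * b\<^sup>2\<bar> = 1 \<or>
       y = of_int (s * b') / of_int b \<and> \<bar>b'\<^sup>2 - v * m * b' * b - \<epsilon> * v * b\<^sup>2\<bar> = 1)"
  proof
    assume h: "x = of_int (s * v * a') / of_int a \<and> \<bar>v * a'\<^sup>2 - v * m * a' * a - \<epsilon> * a\<^sup>2\<bar> = 1"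
    \<comment> \<open>This is the next term of the recurrence for \<open>a_seq\<close>; the
      coefficient \<open>v\<close> appears in this alternative and 1 in the other. One step swaps
      the two quadratic forms and multiplies the value by \<open>- \<epsilon>\<close>.\<close>
    define b where "b = v * m * a' + \<epsilon> * a"
    have y: "y = of_int (s * b) / of_int a'"
      using a assms(1,2) unfolding y_def b_def conjunct1[OF h]
      by (simp add: field_simps power2_eq_square)
    hence "b > 0" using \<open>y > 0\<close> a assms(1) by (simp add: zero_less_divide_iff zero_less_mult_iff)
    moreover have "b\<^sup>2 - v * m * b * a' - \<epsilon> * v * a'\<^sup>2
        = - \<epsilon> * (v * a'\<^sup>2 - v * m * a' * a - \<epsilon> * a\<^sup>2)"
      using assms(4) by (auto simp: b_def power2_eq_square algebra_simps)
    hence "\<bar>b\<^sup>2 - v * m * b * a' - \<epsilon> * v * a'\<^sup>2\<bar> = 1" using h assms(4) by (auto simp: abs_mult)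
    ultimately show ?thesis using y a by blast
  next
    assume h: "x = of_int (s * a') / of_int a \<and> \<bar>a'\<^sup>2 - v * m * a' * a - \<epsilon> * v * a\<^sup>2\<bar> = 1"
    define b where "b = m * a' + \<epsilon> * a"
    have y: "y = of_int (s * v * b) / of_int a'"
      using a assms(1,2) unfolding y_def b_def conjunct1[OF h]
      by (simp add: field_simps power2_eq_square)
    hence "s * v * b > 0"
      using \<open>y > 0\<close> a by (simp only: zero_less_divide_iff of_int_0_less_iff of_int_less_0_iff) auto
    hence "b > 0" by (rule zero_less_mult_pos) (use assms(1,2) in simp)
    moreover have "v * b\<^sup>2 - v * m * b * a' - \<epsilon> * a'\<^sup>2
        = - \<epsilon> * (a'\<^sup>2 - v * m * a' * a - \<epsilon> * v * a\<^sup>2)"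
      using assms(4) by (auto simp: b_def power2_eq_square algebra_simps)
    hence "\<bar>v * b\<^sup>2 - v * m * b * a' - \<epsilon> * a'\<^sup>2\<bar> = 1" using h assms(4) by (auto simp: abs_mult)
    ultimately show ?thesis using y a by blast
  qed
  thus ?case using fy y1 y2 by blast
qed

text \<open>The conjugate factor \<open>p - q * \<xi>'\<close> exceeds \<open>q * N\<close>, so a
  norm of size at most \<open>N\<close> leaves less than \<open>1 / q\<close> for
  \<open>\<bar>p - q * \<xi>\<bar>\<close>. Irrationality makes that factor nonzero and the estimate
  strict.\<close>

lemma semiconvergent_if_small_norm:
  fixes p q N :: int and \<xi> \<xi>' :: real
  assumes "\<xi> > 0" "\<xi> \<notin> \<rat>" "p > 0" "q > 0"
    and norm: "\<bar>(of_int p - of_int q * \<xi>) * (of_int p - of_int q * \<xi>')\<bar> \<le> of_int N"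
    and far: "of_int p / of_int q - \<xi>' > of_int N" and "N > 0"
  shows "semiconvergent \<xi> (of_int p / of_int q)"
proof (rule semiconvergent_if_close[OF assms(1-4)])
  let ?t = "\<bar>of_int p - of_int q * \<xi>\<bar>"
  have "?t \<noteq> 0"
  proof
    assume "?t = 0"
    hence "\<xi> = of_int p / of_int q" using assms(4) by (simp add: field_simps)
    thus False using assms(2) by auto
  qed
  hence t: "?t > 0" by simp
  have far': "of_int q * of_int N < of_int p - of_int q * \<xi>'"
    using far assms(4) by (simp add: field_simps)
  moreover have "(0::real) < of_int q * of_int N" using assms(4,7) by simp
  ultimately have "?t * (of_int p - of_int q * \<xi>') \<le> of_int N" using norm by (simp add: abs_mult)
  moreover have "?t * (of_int q * of_int N) < ?t * (of_int p - of_int q * \<xi>')"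
    using far' t by (rule mult_strict_left_mono)
  ultimately have "(?t * of_int q) * of_int N < 1 * of_int N" by (simp add: mult_ac)
  thus "?t * of_int q < 1" using assms(7) by (simp only: mult_less_cancel_right of_int_0_less_iff)
qed

theorem theorem4p3:
  fixes s v m \<epsilon> :: int and d k \<xi> \<xi>' :: real
  assumes "s > 0" and "v > 0" and "m > 0"
    and "\<epsilon> \<in> {1, -1}"
    and "\<not> (\<epsilon> = -1 \<and> v * m\<^sup>2 \<le> 4)"
    and "d = real_of_int (s * v * m) / 2"
    and "k = real_of_int (s\<^sup>2 * v * (v * m\<^sup>2 + 4 * \<epsilon>)) / 4"
    and "\<xi> = d + sqrt k"
    and "\<xi>' = d - sqrt k"
    and "\<bar>\<xi>'\<bar> < 1"
  shows "(\<forall>c \<in> sset (pattern_cf s v m \<epsilon>). c \<ge> 0) \<and>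
         (\<forall>n\<ge>1. \<exists>y. (f_xi s v m \<epsilon> ^^ n) None = Some y \<and> semiconvergent \<xi> y)"
proof -
  have "v * m\<^sup>2 + 4 * \<epsilon> > 0"
    using assms(2-5) by (auto simp: add_pos_pos)
  hence "s\<^sup>2 * v * (v * m\<^sup>2 + 4 * \<epsilon>) > 0" using assms(1,2) by simp
  hence "k > 0" unfolding assms(7) by (simp only: of_int_0_less_iff zero_less_divide_iff) simp
  have "s * v * m > 0" using assms(1-3) by simp
  hence "d > 0" unfolding assms(6) by (simp only: of_int_0_less_iff zero_less_divide_iff) simp
  have "\<xi> > 0" using \<open>k > 0\<close> \<open>d > 0\<close> assms(8) by (simp add: add_pos_pos)
  have sum: "\<xi> + \<xi>' = of_int (s * v * m)" using assms(6,8,9) by simp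
  have "\<xi> * \<xi>' = d\<^sup>2 - k"
    using \<open>k > 0\<close> unfolding assms(8,9) by (simp add: algebra_simps power2_eq_square)
  hence prod: "\<xi> * \<xi>' = - of_int (\<epsilon> * s\<^sup>2 * v)"
    unfolding assms(6,7) by (simp add: field_simps power2_eq_square)
  \<comment> \<open>Evaluated at \<open>(\<xi>, 1)\<close> for the quadratic equation, at
    \<open>(-1, 1)\<close> and \<open>(1, 1)\<close> for the size of \<open>m\<close>, and at
    numerator and denominator of each iterate.\<close>
  have norm: "(x - y * \<xi>) * (x - y * \<xi>') =
      x\<^sup>2 - of_int (s * v * m) * x * y - of_int (\<epsilon> * s\<^sup>2 * v) * y\<^sup>2" for x y
  proof -
    have "(x - y * \<xi>) * (x - y * \<xi>') = x\<^sup>2 - (\<xi> + \<xi>') * x * y + (\<xi> * \<xi>') * y\<^sup>2"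
      by (simp add: algebra_simps power2_eq_square)
    thus ?thesis by (simp only: sum prod)
  qed
  have "\<xi>' \<noteq> 0" using prod assms(1,2,4) by auto
  have irr: "\<xi> \<notin> \<rat>"
  proof
    assume "\<xi> \<in> \<rat>"
    moreover have "\<xi>\<^sup>2 - of_int (s * v * m) * \<xi> - of_int (\<epsilon> * s\<^sup>2 * v) = 0"
      using norm[of \<xi> 1] by simp
    ultimately have "\<xi> \<in> \<int>" by (rule int_if_rational_root)
    hence "of_int (s * v * m) - \<xi> \<in> \<int>" by (intro Ints_diff) auto
    moreover have "\<xi>' = of_int (s * v * m) - \<xi>" using sum by linarith
    ultimately have "\<xi>' \<in> \<int>" by (simp only:)
    then obtain j where "\<xi>' = of_int j" by (rule Ints_cases)
    thus False using \<open>\<xi>' \<noteq> 0\<close> assms(10) by simp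
  qed
  \<comment> \<open>The sign of the norm at \<open>(- \<epsilon>, 1)\<close> is known from
    \<open>\<bar>\<xi>'\<bar> < 1\<close>; integrality sharpens the strict inequality. The common
    factor \<open>s * v\<close> is kept so that it can be cancelled below.\<close>
  have large: "(\<epsilon> = 1 \<and> s * (s * v) \<le> m * (s * v)) \<or> (\<epsilon> = -1 \<and> s * (s * v) + 2 \<le> m * (s * v))"
  proof (cases "\<epsilon> = 1")
    case True
    have "0 < (-1 - \<xi>) * (-1 - \<xi>')"
      using \<open>\<xi> > 0\<close> assms(10) by (intro mult_neg_neg) auto
    hence "real_of_int 0 < of_int (1 + s * v * m - s\<^sup>2 * v)"
      using norm[of "-1" 1] True by simp
    hence "0 < 1 + s * v * m - s\<^sup>2 * v" by (simp only: of_int_less_iff)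
    thus ?thesis using True by (simp add: power2_eq_square algebra_simps)
  next
    case False
    hence \<epsilon>: "\<epsilon> = -1" using assms(4) by simp
    have "s\<^sup>2 * v \<ge> 1" using assms(1,2) by (simp add: int_one_le_iff_zero_less)
    hence "\<xi> * \<xi>' \<ge> 1" using prod \<epsilon> by (simp flip: of_int_power of_int_mult)
    moreover have "\<xi> * \<xi>' < \<xi>" using \<open>\<xi> > 0\<close> assms(10) by simp
    ultimately have "(1 - \<xi>) * (1 - \<xi>') < 0"
      using assms(10) by (intro mult_neg_pos) auto
    hence "real_of_int (1 - s * v * m + s\<^sup>2 * v) < of_int 0"
      using norm[of 1 1] \<epsilon> by simp
    hence "1 - s * v * m + s\<^sup>2 * v < 0" by (simp only: of_int_less_iff)
    thus ?thesis using \<epsilon> by (simp add: power2_eq_square algebra_simps)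
  qed
  have "s * v > 0" using assms(1,2) by simp
  have "s \<le> m"
  proof -
    have "s * (s * v) \<le> m * (s * v)" using large by linarith
    thus ?thesis using \<open>s * v > 0\<close> by (rule mult_right_le_imp_le)
  qed
  moreover have "s < m" if "\<epsilon> = -1"
  proof -
    have "s * (s * v) < m * (s * v)" using large that by linarith
    thus ?thesis by (rule mult_right_less_imp_less) (use \<open>s * v > 0\<close> in simp)
  qed
  ultimately have nonneg: "\<forall>c \<in> sset (pattern_cf s v m \<epsilon>). c \<ge> 0"
    using pattern_cf_nonneg[OF assms(1-4)] by blast
  have "\<exists>y. (f_xi s v m \<epsilon> ^^ n) None = Some y \<and> semiconvergent \<xi> y" if "n \<ge> 1" for n
  proof -
    obtain n' where n: "n = Suc n'" using \<open>n \<ge> 1\<close> by (cases n) auto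
    obtain x a a' where x: "(f_xi s v m \<epsilon> ^^ n) None = Some x"
      and lower: "\<epsilon> = 1 \<Longrightarrow> x \<ge> of_int (s * v * m)" "\<epsilon> = -1 \<Longrightarrow> x > \<xi>"
      and a: "a > 0" "a' > 0"
      and cases: "x = of_int (s * v * a') / of_int a \<and> \<bar>v * a'\<^sup>2 - v * m * a' * a - \<epsilon> * a\<^sup>2\<bar> = 1 \<or>
        x = of_int (s * a') / of_int a \<and> \<bar>a'\<^sup>2 - v * m * a' * a - \<epsilon> * v * a\<^sup>2\<bar> = 1"
      using f_xi_iterate[OF assms(1-4) sum prod \<open>\<xi> > 0\<close>, of n'] unfolding n by blast
    have far: "x - \<xi>' > of_int (s\<^sup>2 * v)"
    proof (cases "\<epsilon> = 1")
      case True
      have "\<xi> * \<xi>' < 0" using prod True assms(1,2) by simp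
      hence "\<xi>' < 0" using \<open>\<xi> > 0\<close> by (simp add: mult_less_0_iff)
      moreover have "s\<^sup>2 * v \<le> s * v * m" using large True by (simp add: power2_eq_square mult_ac)
      hence "real_of_int (s\<^sup>2 * v) \<le> of_int (s * v * m)" by (simp only: of_int_le_iff)
      ultimately show ?thesis using lower(1)[OF True] by linarith
    next
      case False
      hence \<epsilon>: "\<epsilon> = -1" using assms(4) by simp
      \<comment> \<open>The surplus 2 pays for \<open>2 * \<xi>' < 2\<close>, as
        \<open>x - \<xi>' > \<xi> - \<xi>' = (\<xi> + \<xi>') - 2 * \<xi>'\<close>.\<close>
      have "s\<^sup>2 * v + 2 \<le> s * v * m" using large \<epsilon> by (simp add: power2_eq_square mult_ac)
      hence "real_of_int (s\<^sup>2 * v + 2) \<le> of_int (s * v * m)" by (simp only: of_int_le_iff)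
      hence "real_of_int (s\<^sup>2 * v) + 2 \<le> \<xi> + \<xi>'" using sum by simp
      thus ?thesis using lower(2)[OF \<epsilon>] assms(10) by linarith
    qed
    have N: "s\<^sup>2 * v > 0" using assms(1,2) by simp
    \<comment> \<open>One bound serves both alternatives: the norm is \<open>s\<^sup>2 * v\<close>
      in the first and \<open>s\<^sup>2\<close> in the second, up to sign.\<close>
    have sc: "semiconvergent \<xi> x"
      if "x = of_int p / of_int a" "p > 0"
        and bound: "\<bar>p\<^sup>2 - s * v * m * p * a - \<epsilon> * s\<^sup>2 * v * a\<^sup>2\<bar> \<le> s\<^sup>2 * v" for p
    proof -
      have "(of_int p - of_int a * \<xi>) * (of_int p - of_int a * \<xi>') =
          of_int (p\<^sup>2 - s * v * m * p * a - \<epsilon> * s\<^sup>2 * v * a\<^sup>2)"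
        unfolding norm by simp
      moreover have "\<bar>real_of_int (p\<^sup>2 - s * v * m * p * a - \<epsilon> * s\<^sup>2 * v * a\<^sup>2)\<bar> \<le> of_int (s\<^sup>2 * v)"
        using bound by (simp only: of_int_abs[symmetric] of_int_le_iff)
      ultimately show ?thesis
        using semiconvergent_if_small_norm[OF \<open>\<xi> > 0\<close> irr that(2) a(1), of \<xi>' "s\<^sup>2 * v"] far N that(1)
        by (simp only:)
    qed
    from cases have "semiconvergent \<xi> x"
    proof
      assume h: "x = of_int (s * v * a') / of_int a \<and> \<bar>v * a'\<^sup>2 - v * m * a' * a - \<epsilon> * a\<^sup>2\<bar> = 1"
      have "(s * v * a')\<^sup>2 - s * v * m * (s * v * a') * a - \<epsilon> * s\<^sup>2 * v * a\<^sup>2 =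
          s\<^sup>2 * v * (v * a'\<^sup>2 - v * m * a' * a - \<epsilon> * a\<^sup>2)"
        by (simp add: algebra_simps power2_eq_square)
      thus ?thesis using sc[of "s * v * a'"] h a assms(1,2) by (simp add: abs_mult)
    next
      assume h: "x = of_int (s * a') / of_int a \<and> \<bar>a'\<^sup>2 - v * m * a' * a - \<epsilon> * v * a\<^sup>2\<bar> = 1"
      have "(s * a')\<^sup>2 - s * v * m * (s * a') * a - \<epsilon> * s\<^sup>2 * v * a\<^sup>2 =
          s\<^sup>2 * (a'\<^sup>2 - v * m * a' * a - \<epsilon> * v * a\<^sup>2)"
        by (simp add: algebra_simps power2_eq_square)
      thus ?thesis using sc[of "s * a'"] h a assms(1,2) by (simp add: abs_mult)
    qed
    thus ?thesis using x by blast
  qed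
  thus ?thesis using nonneg by blast
qed

end
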